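(* Let $R$ be a lie restriction and $G$ a lie restriction graph for $R$ with start vertex $a$. The Seeker wins the Renyi-Ulam game with lie restriction $R$ from every position mapping $a$ to $n$ and all other vertices to $0$ ($n\ge1$) if and only if the Seeker wins the two-string game for $R$ from every starting position $(u,u)$ in which the two initial strings are equal (with $u\in R$).
   Context: A lie restriction $R$ is a set of finite binary strings that is prefix-closed and extensible. A lie restriction graph $G$ for $R$ is a directed graph with a designated start vertex, arcs labeled $0$ or $1$, each vertex having one or two outgoing arcs with at most one of each label, such that a binary string lies in $R$ iff it is the label sequence of a directed path in $G$ from the start vertex. A position is a map $P$ from vertices to nonnegative integers with finite support; its weight is $\sum_v P(v)$. $(P_1,P_2)$ is a split of $P$ if there are positions $Q_0,Q_1$ with $P=Q_0+Q_1$, $P_1(v)=\sum Q_0(u)$ over $u$ with a $0$-arc $u\to v$, $P_2(v)=\sum Q_1(u)$ over $u$ with a $1$-arc $u\to v$. A strategy tree for $P$ is a finite rooted binary tree of positions with root $P$, children of each non-leaf forming a split, leaves of weight $0$ or $1$; the Seeker wins from $P$ iff a strategy tree exists. Two-string game for $R$: the state is two binary strings $u_1,u_2$. On each turn the Obscurer appends a letter to one of the two strings of her choice, then the Seeker appends a letter to the other. The Seeker wins if at some point (after either player's move) one of the strings is not in $R$; the Obscurer wins if this never happens.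
   Formalization: The split is corrected: P_1 sums Q_0 over 0-arcs plus Q_1 over 1-arcs, and P_2 sums Q_0 over 1-arcs plus Q_1 over 0-arcs; with the split as worded the Seeker would win from every position, so the equivalence fails for R = all binary strings. *)

theory Defs
  imports "Graph_Theory.Arc_Walk" "HOL-Library.Sublist"
begin

text \<open>Binary letters are booleans: \<open>False\<close> is \<open>0\<close> and \<open>True\<close> is \<open>1\<close>.\<close>

definition lie_restriction :: "bool list set \<Rightarrow> bool" where
  "lie_restriction R \<longleftrightarrow>
     (\<forall>w\<in>R. \<forall>u. prefix u w \<longrightarrow> u \<in> R) \<and>
     (\<forall>u\<in>R. \<exists>x. u @ [x] \<in> R)"

text \<open>The graph may be infinite. Directed paths may repeat vertices and arcs
  (they are walks), as label sequences of arbitrary length are needed.\<close>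

locale lie_restriction_graph = wf_digraph G
  for G :: "('a, 'b) pre_digraph" +
  fixes lab :: "'b \<Rightarrow> bool" and start :: 'a and R :: "bool list set"
  assumes start_in_verts: "start \<in> verts G"
    and out_degree: "v \<in> verts G \<Longrightarrow> card (out_arcs G v) \<in> {1, 2}"
    and labels_distinct: "v \<in> verts G \<Longrightarrow> inj_on lab (out_arcs G v)"
    and language: "w \<in> R \<longleftrightarrow> (\<exists>p v. awalk start p v \<and> map lab p = w)"


section \<open>The Renyi-Ulam game\<close>

definition position :: "('a, 'b) pre_digraph \<Rightarrow> ('a \<Rightarrow> nat) \<Rightarrow> bool" where
  "position G P \<longleftrightarrow> finite {v. P v \<noteq> 0} \<and> {v. P v \<noteq> 0} \<subseteq> verts G"

definition weight :: "('a \<Rightarrow> nat) \<Rightarrow> nat" where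
  "weight P = (\<Sum>v | P v \<noteq> 0. P v)"

text \<open>All candidates of \<open>Q\<close> move along arcs labelled \<open>x\<close>; those at a vertex without such
  an arc are discarded. The sum is restricted to the support of \<open>Q\<close>, because a vertex can
  have infinitely many predecessors and \<^const>\<open>sum\<close> vanishes on infinite sets.\<close>

definition advance ::
  "('a, 'b) pre_digraph \<Rightarrow> ('b \<Rightarrow> bool) \<Rightarrow> bool \<Rightarrow> ('a \<Rightarrow> nat) \<Rightarrow> 'a \<Rightarrow> nat" where
  "advance G lab x Q v =
     (\<Sum>u | Q u \<noteq> 0 \<and> (\<exists>e\<in>arcs G. tail G e = u \<and> head G e = v \<and> lab e = x). Q u)"

text \<open>A question separates the candidates \<open>P\<close> into \<open>Q0\<close> and \<open>Q1\<close>. One of the two answers is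
  true (letter \<open>0\<close>) for the candidates in \<open>Q0\<close> and a lie (letter \<open>1\<close>) for those in \<open>Q1\<close>; for
  the other answer the letters are exchanged. So, whatever the answer, both parts advance,
  along arcs with opposite labels.\<close>

definition is_split ::
  "('a, 'b) pre_digraph \<Rightarrow> ('b \<Rightarrow> bool) \<Rightarrow> ('a \<Rightarrow> nat) \<Rightarrow> ('a \<Rightarrow> nat) \<Rightarrow> ('a \<Rightarrow> nat) \<Rightarrow> bool" where
  "is_split G lab P P1 P2 \<longleftrightarrow>
     (\<exists>Q0 Q1. position G Q0 \<and> position G Q1 \<and>
        (\<forall>v. P v = Q0 v + Q1 v) \<and>
        (\<forall>v. P1 v = advance G lab False Q0 v + advance G lab True Q1 v) \<and>
        (\<forall>v. P2 v = advance G lab True Q0 v + advance G lab False Q1 v))"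

datatype 'a position_tree =
    Leaf (root: "'a \<Rightarrow> nat")
  | Node "'a position_tree" (root: "'a \<Rightarrow> nat") "'a position_tree"

primrec strategy_tree ::
  "('a, 'b) pre_digraph \<Rightarrow> ('b \<Rightarrow> bool) \<Rightarrow> 'a position_tree \<Rightarrow> bool" where
  "strategy_tree G lab (Leaf P) \<longleftrightarrow> position G P \<and> weight P \<in> {0, 1}"
| "strategy_tree G lab (Node l P r) \<longleftrightarrow>
     position G P \<and> is_split G lab P (root l) (root r) \<and>
     strategy_tree G lab l \<and> strategy_tree G lab r"

definition seeker_wins ::
  "('a, 'b) pre_digraph \<Rightarrow> ('b \<Rightarrow> bool) \<Rightarrow> ('a \<Rightarrow> nat) \<Rightarrow> bool" where
  "seeker_wins G lab P \<longleftrightarrow> (\<exists>t. strategy_tree G lab t \<and> root t = P)"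


section \<open>The two-string game\<close>

datatype side = First | Second

fun other :: "side \<Rightarrow> side" where
  "other First = Second"
| "other Second = First"

type_synonym state = "bool list \<times> bool list"

fun append_to :: "side \<Rightarrow> bool \<Rightarrow> state \<Rightarrow> state" where
  "append_to First x (u1, u2) = (u1 @ [x], u2)"
| "append_to Second x (u1, u2) = (u1, u2 @ [x])"

text \<open>The Obscurer's move \<open>(i, x)\<close> appends the letter \<open>x\<close> to the string \<open>i\<close>.
  A strategy of the Seeker maps the nonempty list of all moves of the Obscurer so far, in
  chronological order, to the Seeker's next letter. Her own earlier moves are determined by
  that list, so this is a strategy with full knowledge of the history.\<close>

type_synonym obscurer_move = "side \<times> bool"
type_synonym seeker_strategy = "obscurer_move list \<Rightarrow> bool"

definition after_obscurer :: "obscurer_move \<Rightarrow> state \<Rightarrow> state" where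
  "after_obscurer m s = append_to (fst m) (snd m) s"

definition after_seeker :: "obscurer_move \<Rightarrow> bool \<Rightarrow> state \<Rightarrow> state" where
  "after_seeker m y s = append_to (other (fst m)) y s"

text \<open>State after \<open>n\<close> complete turns, when the Obscurer plays the moves \<open>\<omega> 0, \<omega> 1, \<dots>\<close>\<close>

primrec play :: "seeker_strategy \<Rightarrow> (nat \<Rightarrow> obscurer_move) \<Rightarrow> state \<Rightarrow> nat \<Rightarrow> state" where
  "play \<sigma> \<omega> s 0 = s"
| "play \<sigma> \<omega> s (Suc n) =
     after_seeker (\<omega> n) (\<sigma> (map \<omega> [0..<Suc n])) (after_obscurer (\<omega> n) (play \<sigma> \<omega> s n))"

definition violates :: "bool list set \<Rightarrow> state \<Rightarrow> bool" where
  "violates R s \<longleftrightarrow> fst s \<notin> R \<or> snd s \<notin> R"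

definition seeker_wins_two_string :: "bool list set \<Rightarrow> state \<Rightarrow> bool" where
  "seeker_wins_two_string R s \<longleftrightarrow>
     (\<exists>\<sigma>. \<forall>\<omega>. \<exists>n. violates R (after_obscurer (\<omega> n) (play \<sigma> \<omega> s n)) \<or>
                  violates R (play \<sigma> \<omega> s (Suc n)))"

end

theory Submission
  imports Defs
begin

text \<open>
  Two candidates with histories \<open>u1\<close> and \<open>u2\<close> play a game in which the Seeker first decides
  whether the two next letters agree, and the Obscurer then picks the letters. The two-string
  game is equivalent to it: in a state of the two-string game, call a pair of next
  letters good if the Seeker wins after it. These pairs are the edges of a cycle of
  length four whose vertices are the Obscurer's moves, and the Seeker wins iff the good edges
  cover all vertices, iff they contain a perfect matching.

  If the Seeker wins with \<open>2 * 2 ^ length u\<close> candidates, then the Obscurer can steer two of them to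
  the history \<open>u\<close> by following the majority, so the Seeker wins the two-candidate
  game from \<open>(u, u)\<close>. Conversely, \<open>n + 1\<close> candidates with a common history are treated as two, one
  of them standing for \<open>n\<close> candidates that move together; when one of the two is eliminated, either
  at most one candidate or \<open>n\<close> candidates with a common history remain.
\<close>

section \<open>The two-candidate game\<close>

text \<open>\<open>c\<close> is the exclusive or of the two new letters: \<open>False\<close> models
  a question with both candidates in one part, \<open>True\<close> one that separates them. As a
  least fixed point, the predicate demands a violation after finitely many turns.\<close>

inductive seeker_forces :: "bool list set \<Rightarrow> state \<Rightarrow> bool" for R where
  violated: "violates R s \<Longrightarrow> seeker_forces R s"
| step: "(\<And>x. seeker_forces R (u1 @ [x], u2 @ [x \<noteq> c])) \<Longrightarrow> seeker_forces R (u1, u2)"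

text \<open>The pair \<open>(x, y)\<close> is the edge joining the moves \<open>(First, x)\<close>
  and \<open>(Second, y)\<close>. If both perfect matchings lacked an edge, the two missing edges
  would share a vertex and leave it uncovered. \<open>Q\<close> is generic because it is used both
  for \<open>seeker_forces\<close> and for the existence of a strategy.\<close>

lemma matching_iff_cover:
  "(\<forall>m. \<exists>y. Q (after_seeker m y (after_obscurer m (u1, u2)))) \<longleftrightarrow>
   (\<exists>c. \<forall>x. Q (u1 @ [x], u2 @ [x \<noteq> c]))" (is "?cover \<longleftrightarrow> ?matching")
proof
  assume cover: ?cover
  have 1: "\<exists>y. Q (u1 @ [x], u2 @ [y])" for x
    using cover[rule_format, of "(First, x)"] by (simp add: after_seeker_def after_obscurer_def)
  have 2: "\<exists>x. Q (u1 @ [x], u2 @ [y])" for y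
    using cover[rule_format, of "(Second, y)"] by (simp add: after_seeker_def after_obscurer_def)
  show ?matching
    using 1[of True] 1[of False] 2[of True] 2[of False] by (simp add: ex_bool_eq all_bool_eq) blast
next
  assume ?matching
  then obtain c where c: "\<And>x. Q (u1 @ [x], u2 @ [x \<noteq> c])" by blast
  show ?cover
  proof
    fix m :: obscurer_move
    obtain i x where m: "m = (i, x)" by fastforce
    have "Q (after_seeker m (x \<noteq> c) (after_obscurer m (u1, u2)))"
    proof (cases i)
      case First
      then show ?thesis using c[of x] m by (simp add: after_seeker_def after_obscurer_def)
    next
      case Second
      have "((x \<noteq> c) \<noteq> c) = x" by blast
      with Second show ?thesis
        using c[of "x \<noteq> c"] m by (simp add: after_seeker_def after_obscurer_def)
    qed
    then show "\<exists>y. Q (after_seeker m y (after_obscurer m (u1, u2)))" ..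
  qed
qed

section \<open>Strategies in the two-string game versus \<open>seeker_forces\<close>\<close>

lemma violates_append_to:
  assumes "lie_restriction R" "violates R s"
  shows "violates R (append_to i x s)"
proof -
  have "u \<in> R" if "u @ [x] \<in> R" for u
    using assms(1) that unfolding lie_restriction_def by (meson prefixI)
  with assms(2) show ?thesis
    by (cases s; cases i) (auto simp: violates_def)
qed

text \<open>By prefix-closedness a string that has left \<open>R\<close> never returns, so the
  states in mid-turn can be ignored.\<close>

lemma violates_play_Suc:
  assumes "lie_restriction R"
    and "violates R (play \<sigma> \<omega> s n) \<or> violates R (after_obscurer (\<omega> n) (play \<sigma> \<omega> s n))"
  shows "violates R (play \<sigma> \<omega> s (Suc n))"
  using assms(2) violates_append_to[OF assms(1)]
  unfolding play.simps after_seeker_def after_obscurer_def by blast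

lemma seeker_wins_two_string_iff_violates_play:
  assumes "lie_restriction R"
  shows "seeker_wins_two_string R s \<longleftrightarrow> (\<exists>\<sigma>. \<forall>\<omega>. \<exists>n. violates R (play \<sigma> \<omega> s n))"
  unfolding seeker_wins_two_string_def using violates_play_Suc[OF assms] by meson

text \<open>\<open>play\<close> recurses on the last turn, whereas \<open>seeker_forces\<close>
  unfolds the first one; this peels off the first turn.\<close>

lemma play_Suc_shift:
  "play \<sigma> \<omega> s (Suc n) =
   play (\<lambda>ms. \<sigma> (\<omega> 0 # ms)) (\<lambda>k. \<omega> (Suc k))
     (after_seeker (\<omega> 0) (\<sigma> [\<omega> 0]) (after_obscurer (\<omega> 0) s)) n"
proof (induction n)
  case (Suc n)
  have "map \<omega> [0..<Suc (Suc n)] = \<omega> 0 # map (\<lambda>k. \<omega> (Suc k)) [0..<Suc n]"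
    by (simp add: map_upt_Suc del: upt_Suc)
  then show ?case
    using Suc.IH by (simp only: play.simps(2)[of _ _ _ "Suc n"] play.simps(2)[of _ _ _ n])
qed simp

lemma seeker_forces_imp_strategy:
  "seeker_forces R s \<Longrightarrow> \<exists>\<sigma>. \<forall>\<omega>. \<exists>n. violates R (play \<sigma> \<omega> s n)"
proof (induction rule: seeker_forces.induct)
  case (violated s)
  then have "violates R (play \<sigma> \<omega> s 0)" for \<sigma> \<omega> by simp
  then show ?case by blast
next
  case (step u1 u2 c)
  let ?Q = "\<lambda>s. \<exists>\<sigma>. \<forall>\<omega>. \<exists>n. violates R (play \<sigma> \<omega> s n)"
  have "\<forall>m. \<exists>y. ?Q (after_seeker m y (after_obscurer m (u1, u2)))"
    unfolding matching_iff_cover[of ?Q u1 u2] using step.IH by blast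
  then obtain y \<tau> where
    \<tau>: "\<And>m \<omega>. \<exists>n. violates R (play (\<tau> m) \<omega> (after_seeker m (y m) (after_obscurer m (u1, u2))) n)"
    by metis
  \<comment> \<open>Glues the strategies: \<open>y\<close> answers the first move, then the
    continuation chosen for that move takes over with the rest of the history.\<close>
  define \<sigma> where "\<sigma> ms = (if tl ms = [] then y (hd ms) else \<tau> (hd ms) (tl ms))" for ms
  have "\<exists>n. violates R (play \<sigma> \<omega> (u1, u2) n)" for \<omega>
  proof -
    let ?s = "after_seeker (\<omega> 0) (y (\<omega> 0)) (after_obscurer (\<omega> 0) (u1, u2))"
    let ?\<omega> = "\<lambda>k. \<omega> (Suc k)"
    \<comment> \<open>The two strategies may differ on the empty history, but \<open>play\<close>
      only queries nonempty ones.\<close>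
    have "play (\<lambda>ms. \<sigma> (\<omega> 0 # ms)) ?\<omega> ?s n = play (\<tau> (\<omega> 0)) ?\<omega> ?s n" for n
      by (induction n) (simp_all add: \<sigma>_def)
    then have "play \<sigma> \<omega> (u1, u2) (Suc n) = play (\<tau> (\<omega> 0)) ?\<omega> ?s n" for n
      unfolding play_Suc_shift by (simp add: \<sigma>_def)
    with \<tau>[of "\<omega> 0" ?\<omega>] show ?thesis by metis
  qed
  then show ?case by blast
qed

text \<open>Outside \<open>seeker_forces\<close> the Obscurer has a move after which no reply
  re-enters it. Repeating such moves against \<open>\<sigma>\<close> yields a play without
  violation.\<close>

lemma strategy_imp_seeker_forces:
  assumes "\<And>\<omega>. \<exists>n. violates R (play \<sigma> \<omega> s n)"
  shows "seeker_forces R s"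
proof (rule ccontr)
  assume not_forced: "\<not> seeker_forces R s"
  have "\<exists>m. \<forall>y. \<not> seeker_forces R (after_seeker m y (after_obscurer m s))"
    if "\<not> seeker_forces R s" for s
  proof (rule ccontr)
    assume "\<nexists>m. \<forall>y. \<not> seeker_forces R (after_seeker m y (after_obscurer m s))"
    then have "\<forall>m. \<exists>y. seeker_forces R (after_seeker m y (after_obscurer m (fst s, snd s)))"
      by simp
    then have "\<exists>c. \<forall>x. seeker_forces R (fst s @ [x], snd s @ [x \<noteq> c])"
      by (simp only: matching_iff_cover)
    then have "seeker_forces R (fst s, snd s)" by (blast intro: seeker_forces.step)
    with that show False by simp
  qed
  then obtain mv where
    mv: "\<And>s y. \<not> seeker_forces R s \<Longrightarrow>
                 \<not> seeker_forces R (after_seeker (mv s) y (after_obscurer (mv s) s))"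
    by metis
  \<comment> \<open>The moves \<open>\<omega>\<close> depend on the play, and the play on
    \<open>\<omega>\<close>; computing state and history together breaks this circle.\<close>
  define X where "X = rec_nat (s, []) (\<lambda>_ (t, ms).
    (after_seeker (mv t) (\<sigma> (ms @ [mv t])) (after_obscurer (mv t) t), ms @ [mv t]))"
  define \<omega> where "\<omega> n = mv (fst (X n))" for n
  have X: "X n = (play \<sigma> \<omega> s n, map \<omega> [0..<n])" for n
  proof (induction n)
    case 0
    then show ?case by (simp add: X_def)
  next
    case (Suc n)
    then have "\<omega> n = mv (play \<sigma> \<omega> s n)" by (simp add: \<omega>_def[of n])
    moreover have "X (Suc n) = (\<lambda>(t, ms). (after_seeker (mv t) (\<sigma> (ms @ [mv t]))
        (after_obscurer (mv t) t), ms @ [mv t])) (X n)"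
      by (simp add: X_def)
    ultimately show ?case using Suc.IH by simp
  qed
  have "\<not> seeker_forces R (play \<sigma> \<omega> s n)" for n
  proof (induction n)
    case (Suc n)
    have "\<omega> n = mv (play \<sigma> \<omega> s n)" by (simp add: \<omega>_def[of n] X)
    with mv[OF Suc.IH] show ?case by simp
  qed (simp add: not_forced)
  with assms[of \<omega>] show False by (blast intro: seeker_forces.violated)
qed

lemma seeker_wins_two_string_iff_forces:
  assumes "lie_restriction R"
  shows "seeker_wins_two_string R s \<longleftrightarrow> seeker_forces R s"
  unfolding seeker_wins_two_string_iff_violates_play[OF assms]
  using seeker_forces_imp_strategy strategy_imp_seeker_forces by blast


section \<open>Positions\<close>

definition stack :: "nat \<Rightarrow> 'a \<Rightarrow> 'a \<Rightarrow> nat" where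
  "stack k v = (\<lambda>z. if z = v then k else 0)"

lemma finite_support_stack: "finite {z. stack k v z \<noteq> 0}"
  by (rule finite_subset[of _ "{v}"]) (auto simp: stack_def)

lemma position_add:
  assumes "position G P" "position G Q"
  shows "position G (\<lambda>z. P z + Q z)"
proof -
  have "{z. P z + Q z \<noteq> 0} = {z. P z \<noteq> 0} \<union> {z. Q z \<noteq> 0}" by auto
  with assms show ?thesis by (auto simp: position_def)
qed

lemma position_zero: "position G (\<lambda>_. 0)"
  by (simp add: position_def)

lemma position_stack: "v \<in> verts G \<Longrightarrow> position G (stack k v)"
  by (auto simp: position_def stack_def)

lemma weight_superset:
  assumes "finite S" "{z. P z \<noteq> 0} \<subseteq> S"
  shows "weight P = (\<Sum>z\<in>S. P z)"
  unfolding weight_def by (rule sum.mono_neutral_left) (use assms in auto)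

lemma weight_stack: "weight (stack k v) = k"
  by (subst weight_superset[of "{v}"]) (auto simp: stack_def)

text \<open>For \<open>v = w\<close> the hypothesis demands two candidates at \<open>v\<close>. The
  bound excludes leaves of strategy trees.\<close>

lemma two_le_weight:
  assumes "finite {z. P z \<noteq> 0}" "\<And>z. stack 1 v z + stack 1 w z \<le> P z"
  shows "2 \<le> weight P"
proof -
  let ?S = "{z. P z \<noteq> 0}"
  have vw: "{v, w} \<subseteq> ?S" using assms(2)[of v] assms(2)[of w] by (auto simp: stack_def split: if_splits)
  have "(\<Sum>z\<in>?S. stack 1 v z + stack 1 w z) \<le> weight P"
    unfolding weight_def by (rule sum_mono) (rule assms(2))
  moreover have "(\<Sum>z\<in>?S. stack 1 v z + stack 1 w z) = 2"
    using vw assms(1) by (simp add: sum.distrib stack_def sum.delta)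
  ultimately show ?thesis by simp
qed

text \<open>A fixed finite index set in place of the support of \<open>Q\<close> lets sums for
  different positions be compared termwise.\<close>

lemma advance_superset:
  assumes "finite S" "{u. Q u \<noteq> 0} \<subseteq> S"
  shows "advance G lab x Q v =
    (\<Sum>u\<in>S. if \<exists>e\<in>arcs G. tail G e = u \<and> head G e = v \<and> lab e = x then Q u else 0)"
  unfolding advance_def by (rule sum.mono_neutral_cong_left) (use assms in auto)

lemma advance_mono:
  assumes "finite {u. Q u \<noteq> 0}" "\<And>u. P u \<le> Q u"
  shows "advance G lab x P v \<le> advance G lab x Q v"
proof -
  have "{u. P u \<noteq> 0} \<subseteq> {u. Q u \<noteq> 0}"
    using assms(2) by (auto simp: le_zero_eq) (metis gr0I not_le)
  then show ?thesis
    using assms by (subst (1 2) advance_superset[of "{u. Q u \<noteq> 0}"]) (auto intro!: sum_mono)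
qed

lemma advance_add:
  assumes "finite {u. P u \<noteq> 0}" "finite {u. Q u \<noteq> 0}"
  shows "advance G lab x (\<lambda>u. P u + Q u) v = advance G lab x P v + advance G lab x Q v"
  using assms
  by (subst (1 2 3) advance_superset[of "{u. P u \<noteq> 0} \<union> {u. Q u \<noteq> 0}"])
    (auto simp: sum.distrib[symmetric] intro!: sum.cong)

lemma advance_zero: "advance G lab x (\<lambda>_. 0) v = 0"
  by (simp add: advance_def)

lemma advance_stack:
  "advance G lab x (stack k u) v =
    (if \<exists>e\<in>arcs G. tail G e = u \<and> head G e = v \<and> lab e = x then k else 0)"
  by (subst advance_superset[of "{u}"]) (auto simp: stack_def)


section \<open>Moving candidates\<close>

context lie_restriction_graph
begin

definition reaches :: "bool list \<Rightarrow> 'a \<Rightarrow> bool" where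
  "reaches u v \<longleftrightarrow> (\<exists>p. awalk start p v \<and> map lab p = u)"

lemma in_R_iff_reaches: "u \<in> R \<longleftrightarrow> (\<exists>v. reaches u v)"
  by (auto simp: language reaches_def)

lemma reaches_Nil: "reaches [] v \<longleftrightarrow> v = start"
  using start_in_verts by (auto simp: reaches_def awalk_Nil_iff)

lemma reaches_snoc:
  "reaches (u @ [x]) v' \<longleftrightarrow>
   (\<exists>e\<in>arcs G. reaches u (tail G e) \<and> head G e = v' \<and> lab e = x)" (is "?l \<longleftrightarrow> ?r")
proof
  assume ?l
  then obtain p where p: "awalk start p v'" "map lab p = u @ [x]" by (auto simp: reaches_def)
  then obtain q e where q: "p = q @ [e]" "map lab q = u" "lab e = x"
    by (auto simp: map_eq_append_conv)
  with p have "awalk start q (tail G e)" "e \<in> arcs G" "head G e = v'"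
    by (auto simp: awalk_Cons_iff awalk_Nil_iff)
  with q show ?r by (auto simp: reaches_def)
next
  assume ?r
  then obtain e p where "e \<in> arcs G" "awalk start p (tail G e)" "map lab p = u"
    "head G e = v'" "lab e = x"
    by (auto simp: reaches_def)
  then have "awalk start (p @ [e]) v' \<and> map lab (p @ [e]) = u @ [x]"
    by (auto simp: awalk_Cons_iff awalk_Nil_iff)
  then show ?l unfolding reaches_def by blast
qed

lemma arc_unique:
  "\<lbrakk>e \<in> arcs G; e' \<in> arcs G; tail G e = tail G e'; lab e = lab e'\<rbrakk> \<Longrightarrow> e = e'"
  using labels_distinct[of "tail G e"] by (auto simp: inj_on_def)

text \<open>Distinct labels make \<open>G\<close> a deterministic automaton, so a history determines
  the vertex of its candidate.\<close>

lemma reaches_unique: "reaches u v \<Longrightarrow> reaches u v' \<Longrightarrow> v = v'"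
proof (induction u arbitrary: v v' rule: rev_induct)
  case (snoc x u)
  then show ?case by (metis reaches_snoc arc_unique)
qed (simp add: reaches_Nil)

lemma reaches_verts: "reaches u v \<Longrightarrow> v \<in> verts G"
  by (auto simp: reaches_def)

lemma advance_stack_reaches:
  assumes "reaches u v" "reaches (u @ [x]) v'"
  shows "advance G lab x (stack k v) = stack k v'"
proof
  fix z
  have "(\<exists>e\<in>arcs G. tail G e = v \<and> head G e = z \<and> lab e = x) \<longleftrightarrow> z = v'"
    using assms by (metis reaches_snoc reaches_unique)
  then show "advance G lab x (stack k v) z = stack k v' z"
    by (simp add: advance_stack) (simp add: stack_def)
qed

lemma advance_stack_dead:
  assumes "reaches u v" "u @ [x] \<notin> R"
  shows "advance G lab x (stack k v) = (\<lambda>_. 0)"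
proof
  fix z
  have "\<not> (\<exists>e\<in>arcs G. tail G e = v \<and> head G e = z \<and> lab e = x)"
    using assms by (metis reaches_snoc in_R_iff_reaches)
  then show "advance G lab x (stack k v) z = 0" by (auto simp: advance_stack)
qed

text \<open>In the following \<open>Q i\<close> consists of the candidates that move along the arcs labelled \<open>i\<close>
  in the left subtree (\<open>b = False\<close>).\<close>

lemma strategy_tree_NodeE:
  assumes "strategy_tree G lab (Node l P r)"
  obtains Q child where
    "\<And>i. position G (Q i)"
    "\<And>z. P z = Q False z + Q True z"
    "\<And>b z. root (child b) z = advance G lab b (Q False) z + advance G lab (\<not> b) (Q True) z"
    "\<And>b. child b \<in> {l, r}" "\<And>b. strategy_tree G lab (child b)"
proof -
  from assms obtain Q0 Q1 where Q: "position G Q0" "position G Q1"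
      "\<And>v. P v = Q0 v + Q1 v"
      "\<And>v. root l v = advance G lab False Q0 v + advance G lab True Q1 v"
      "\<And>v. root r v = advance G lab True Q0 v + advance G lab False Q1 v"
    by (auto simp: is_split_def)
  show thesis
    by (rule that[of "\<lambda>i. if i then Q1 else Q0" "\<lambda>b. if b then r else l"])
      (use assms Q in auto)
qed

section \<open>From strategy trees to the two-candidate game\<close>

text \<open>Two candidates are tracked down the tree, with an inequality because others may be
  present. They cannot survive to a leaf, so one of them is eliminated on every branch.\<close>

lemma two_candidates_imp_forces:
  assumes "strategy_tree G lab t" "reaches u1 v" "reaches u2 w"
    "\<And>z. stack 1 v z + stack 1 w z \<le> root t z"
  shows "seeker_forces R (u1, u2)"
  using assms
proof (induction t arbitrary: u1 u2 v w)
  case (Leaf P)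
  then have "2 \<le> weight P" by (intro two_le_weight) (auto simp: position_def)
  with Leaf.prems(1) show ?case by auto
next
  case (Node l P r)
  obtain Q child where Q: "\<And>i. position G (Q i)"
    and P: "\<And>z. P z = Q False z + Q True z"
    and child: "\<And>b z. root (child b) z = advance G lab b (Q False) z + advance G lab (\<not> b) (Q True) z"
    and lr: "\<And>b. child b \<in> {l, r}" and tree: "\<And>b. strategy_tree G lab (child b)"
    using strategy_tree_NodeE[OF Node.prems(1)] by metis
  have fin: "finite {z. Q i z \<noteq> 0}" for i using Q[of i] by (simp add: position_def)
  have dom: "stack 1 v z + stack 1 w z \<le> Q False z + Q True z" for z
    using Node.prems(4)[of z] P by simp
  \<comment> \<open>Assigns the tracked candidates to parts \<open>i\<close> and \<open>j\<close>.
    The last conjunct ensures that two candidates at the same vertex are not the same one counted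
    twice.\<close>
  have "\<exists>i j. (\<forall>z. stack 1 v z \<le> Q i z) \<and> (\<forall>z. stack 1 w z \<le> Q j z) \<and>
      (i = j \<longrightarrow> (\<forall>z. stack 1 v z + stack 1 w z \<le> Q i z))"
  proof (cases "v = w")
    case True
    have "2 \<le> Q False v + Q True v" using dom[of v] True by (simp add: stack_def)
    then have "(1 \<le> Q False v \<and> 1 \<le> Q True v) \<or> 2 \<le> Q False v \<or> 2 \<le> Q True v" by linarith
    then consider "1 \<le> Q False v" "1 \<le> Q True v" | i where "2 \<le> Q i v" by blast
    then show ?thesis
    proof cases
      case 1
      then show ?thesis using True
        by (intro exI[of _ False] exI[of _ True]) (auto simp: stack_def)
    next
      case 2
      then show ?thesis using True by (intro exI[of _ i]) (auto simp: stack_def)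
    qed
  next
    case False
    have "\<exists>i. 1 \<le> Q i v" "\<exists>j. 1 \<le> Q j w"
      using dom[of v] dom[of w] False by (auto simp: stack_def ex_bool_eq)
    then show ?thesis using False by (fastforce simp: stack_def)
  qed
  then obtain i j where i: "\<And>z. stack 1 v z \<le> Q i z" and j: "\<And>z. stack 1 w z \<le> Q j z"
    and ij: "i = j \<Longrightarrow> stack 1 v z + stack 1 w z \<le> Q i z" for z
    by blast
  \<comment> \<open>In \<open>child b\<close>, part \<open>i\<close> moves along arcs labelled
    \<open>b \<noteq> i\<close>.\<close>
  have forced: "seeker_forces R (u1 @ [b \<noteq> i], u2 @ [b \<noteq> j])" for b
  proof (cases "u1 @ [b \<noteq> i] \<in> R \<and> u2 @ [b \<noteq> j] \<in> R")
    case True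
    then obtain v' w' where v': "reaches (u1 @ [b \<noteq> i]) v'" and w': "reaches (u2 @ [b \<noteq> j]) w'"
      by (auto simp: in_R_iff_reaches)
    note adv = advance_stack_reaches[OF Node.prems(2) v'] advance_stack_reaches[OF Node.prems(3) w']
    have v_le: "stack 1 v' z \<le> advance G lab (b \<noteq> i) (Q i) z" for z
      using advance_mono[OF fin i] adv(1) by metis
    have w_le: "stack 1 w' z \<le> advance G lab (b \<noteq> j) (Q j) z" for z
      using advance_mono[OF fin j] adv(2) by metis
    have root_child: "root (child b) z =
        advance G lab (b \<noteq> i) (Q i) z + advance G lab (b \<noteq> (\<not> i)) (Q (\<not> i)) z" for z
      by (cases i) (simp_all add: child)
    have "stack 1 v' z + stack 1 w' z \<le> root (child b) z" for z
    proof (cases "i = j")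
      case True
      have "advance G lab (b \<noteq> i) (\<lambda>z. stack 1 v z + stack 1 w z) z \<le> advance G lab (b \<noteq> i) (Q i) z"
        by (rule advance_mono) (use fin ij True in auto)
      then show ?thesis
        using adv True root_child[of z]
        by (simp add: advance_add[OF finite_support_stack finite_support_stack])
    next
      case False
      then have "j = (\<not> i)" by simp
      with v_le[of z] w_le[of z] root_child[of z] show ?thesis by simp
    qed
    with v' w' tree[of b] lr[of b] show ?thesis using Node.IH by blast
  qed (auto intro!: seeker_forces.violated simp: violates_def)
  \<comment> \<open>Reindexing the children by the first candidate's letter: \<open>b\<close> is
    \<open>x \<noteq> i\<close>, and the letters differ iff the parts do.\<close>
  have "seeker_forces R (u1 @ [x], u2 @ [x \<noteq> (i \<noteq> j)])" for x
  proof -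
    have "((x \<noteq> i) \<noteq> i) = x" "((x \<noteq> i) \<noteq> j) = (x \<noteq> (i \<noteq> j))" by blast+
    then show ?thesis using forced[of "x \<noteq> i"] by simp
  qed
  then show ?case by (rule seeker_forces.step)
qed

text \<open>At each letter of \<open>w\<close>, one part holds at least half of the candidates at
  the current vertex, and one of the two answers moves that part along the letter. The initial
  factor 2 leaves two candidates with history \<open>u @ w\<close>.\<close>

lemma many_candidates_imp_forces:
  assumes "strategy_tree G lab t" "reaches u v" "u @ w \<in> R" "2 * 2 ^ length w \<le> root t v"
    and closed: "lie_restriction R"
  shows "seeker_forces R (u @ w, u @ w)"
  using assms(1-4)
proof (induction w arbitrary: t u v)
  case Nil
  then show ?case
    using two_candidates_imp_forces[of t u v u v] by (simp add: stack_def)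
next
  case (Cons x w)
  have "u @ [x] \<in> R"
    using Cons.prems(3) closed unfolding lie_restriction_def
    by (metis append_Cons append_Nil append_assoc prefixI)
  then obtain v' where v': "reaches (u @ [x]) v'" by (auto simp: in_R_iff_reaches)
  show ?case
  proof (cases t)
    case (Leaf P)
    have "2 \<le> (2::nat) * 2 ^ length (x # w)" by simp
    with Cons.prems(4) have "2 \<le> P v" unfolding Leaf by (metis order_trans position_tree.sel(1))
    then have "2 \<le> weight P"
      using Cons.prems(1) Leaf
      by (intro two_le_weight[of _ v v]) (auto simp: stack_def position_def)
    with Cons.prems(1) Leaf show ?thesis by auto
  next
    case (Node l P r)
    obtain Q child where Q: "\<And>i. position G (Q i)"
      and P: "\<And>z. P z = Q False z + Q True z"
      and child: "\<And>b z. root (child b) z =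
        advance G lab b (Q False) z + advance G lab (\<not> b) (Q True) z"
      and tree: "\<And>b. strategy_tree G lab (child b)"
      using strategy_tree_NodeE[OF Cons.prems(1)[unfolded Node]] by metis
    have "2 * (2 * 2 ^ length w) \<le> Q False v + Q True v"
      using Cons.prems(4) P[of v] Node by simp
    then have "2 * 2 ^ length w \<le> Q False v \<or> 2 * 2 ^ length w \<le> Q True v" by linarith
    then obtain i where i: "2 * 2 ^ length w \<le> Q i v" by blast
    have "stack (2 * 2 ^ length w) v' v' \<le> advance G lab x (Q i) v'"
      unfolding advance_stack_reaches[OF Cons.prems(2) v', symmetric]
      by (rule advance_mono) (use Q i in \<open>auto simp: position_def stack_def\<close>)
    also have "\<dots> \<le> root (child (x \<noteq> i)) v'"
      by (cases i) (simp_all add: child)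
    finally have "2 * 2 ^ length w \<le> root (child (x \<noteq> i)) v'" by (simp add: stack_def)
    with Cons.IH[OF tree v'] Cons.prems(3) show ?thesis by simp
  qed
qed

section \<open>From the two-candidate game to strategy trees\<close>

lemma seeker_wins_leaf:
  "position G P \<Longrightarrow> weight P \<in> {0, 1} \<Longrightarrow> seeker_wins G lab P"
  unfolding seeker_wins_def by (intro exI[of _ "Leaf P"]) simp

lemma seeker_wins_split:
  assumes "position G P" "is_split G lab P P1 P2" "seeker_wins G lab P1" "seeker_wins G lab P2"
  shows "seeker_wins G lab P"
proof -
  from assms obtain l r where "strategy_tree G lab l" "root l = P1" "strategy_tree G lab r" "root r = P2"
    by (auto simp: seeker_wins_def)
  with assms show ?thesis
    unfolding seeker_wins_def by (intro exI[of _ "Node l P r"]) simp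
qed

text \<open>The \<open>k\<close> candidates move as one, so the two-candidate game dictates the
  questions. If the single candidate dies first, \<open>wins\<close> finishes; if the stack dies, at
  most one candidate remains.\<close>

lemma forces_imp_seeker_wins_stack_add:
  assumes wins: "\<And>u v. reaches u v \<Longrightarrow> seeker_wins G lab (stack k v)"
    and "seeker_forces R (u1, u2)" "reaches u1 v" "reaches u2 w"
  shows "seeker_wins G lab (\<lambda>z. stack k v z + stack 1 w z)"
  using assms(2-4)
proof (induction "(u1, u2)" arbitrary: u1 u2 v w rule: seeker_forces.induct)
  case violated
  then show ?case by (auto simp: violates_def in_R_iff_reaches)
next
  case (step u1 u2 c)
  note v = step.prems(1) and w = step.prems(2)
  have pos: "position G (stack k v)" "position G (stack 1 w)"
    using v w by (auto intro: position_stack reaches_verts)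
  let ?P = "\<lambda>x z. advance G lab x (stack k v) z + advance G lab (x \<noteq> c) (stack 1 w) z"
  have P: "seeker_wins G lab (?P x)" for x
  proof (cases "u1 @ [x] \<in> R")
    case True
    then obtain v' where v': "reaches (u1 @ [x]) v'" by (auto simp: in_R_iff_reaches)
    show ?thesis
    proof (cases "u2 @ [x \<noteq> c] \<in> R")
      case True
      then obtain w' where w': "reaches (u2 @ [x \<noteq> c]) w'" by (auto simp: in_R_iff_reaches)
      show ?thesis
        unfolding advance_stack_reaches[OF v v'] advance_stack_reaches[OF w w']
        using step.hyps(2)[OF v' w'] .
    next
      case False
      show ?thesis
        unfolding advance_stack_reaches[OF v v'] advance_stack_dead[OF w False]
        using wins[OF v'] by simp
    qed
  next
    case False
    show ?thesis
    proof (cases "u2 @ [x \<noteq> c] \<in> R")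
      case True
      then obtain w' where w': "reaches (u2 @ [x \<noteq> c]) w'" by (auto simp: in_R_iff_reaches)
      have "seeker_wins G lab (stack 1 w')"
        by (rule seeker_wins_leaf) (use w' in \<open>auto simp: weight_stack intro: position_stack reaches_verts\<close>)
      then show ?thesis
        unfolding advance_stack_dead[OF v False] advance_stack_reaches[OF w w'] by simp
    next
      case dead: False
      show ?thesis
        unfolding advance_stack_dead[OF v False] advance_stack_dead[OF w dead]
        by (rule seeker_wins_leaf) (simp_all add: position_zero weight_def)
    qed
  qed
  \<comment> \<open>For \<open>c = True\<close> the stack and the single candidate form the two
    parts; for \<open>c = False\<close> both lie in \<open>Q0\<close> and \<open>Q1\<close> is
    empty.\<close>
  have "is_split G lab (\<lambda>z. stack k v z + stack 1 w z) (?P False) (?P True)"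
  proof (cases c)
    case True
    show ?thesis
      unfolding is_split_def
      by (intro exI[of _ "stack k v"] exI[of _ "stack 1 w"]) (use pos True in simp)
  next
    case False
    show ?thesis
      unfolding is_split_def
      by (rule exI[of _ "\<lambda>z. stack k v z + stack 1 w z"], rule exI[of _ "\<lambda>_. 0"])
        (use pos False in \<open>simp add: position_add position_zero advance_zero
          advance_add[OF finite_support_stack finite_support_stack]\<close>)
  qed
  then show ?case
    by (rule seeker_wins_split[OF position_add[OF pos] _ P P])
qed

text \<open>The induction must range over all histories \<open>u\<close>, since the stack has moved
  on by the time the single candidate is eliminated.\<close>

lemma forces_imp_seeker_wins_stack:
  assumes "\<And>u. u \<in> R \<Longrightarrow> seeker_forces R (u, u)" "reaches u v"
  shows "seeker_wins G lab (stack n v)"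
  using assms(2)
proof (induction n arbitrary: u v)
  case 0
  then show ?case
    by (intro seeker_wins_leaf) (auto simp: weight_stack intro: position_stack reaches_verts)
next
  case (Suc n)
  have "stack (Suc n) v = (\<lambda>z. stack n v z + stack 1 v z)" by (auto simp: stack_def)
  moreover have "seeker_forces R (u, u)" using assms(1) Suc.prems by (auto simp: in_R_iff_reaches)
  ultimately show ?case
    using forces_imp_seeker_wins_stack_add[OF Suc.IH _ Suc.prems Suc.prems] by simp
qed

end

theorem theorem6:
  fixes R :: "bool list set"
    and G :: "('a, 'b) pre_digraph"
    and lab :: "'b \<Rightarrow> bool"
    and a :: 'a
  assumes "lie_restriction R"
    and "lie_restriction_graph G lab a R"
  shows "(\<forall>n\<ge>1. seeker_wins G lab (\<lambda>v. if v = a then n else 0)) \<longleftrightarrow>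
         (\<forall>u\<in>R. seeker_wins_two_string R (u, u))"
proof -
  interpret lie_restriction_graph G lab a R by (rule assms(2))
  have start: "reaches [] a" by (simp add: reaches_Nil)
  have "seeker_forces R (u, u)"
    if wins: "\<forall>n\<ge>1. seeker_wins G lab (stack n a)" and "u \<in> R" for u
  proof -
    have "seeker_wins G lab (stack (2 * 2 ^ length u) a)" using wins by simp
    then obtain t where "strategy_tree G lab t" "root t = stack (2 * 2 ^ length u) a"
      by (auto simp: seeker_wins_def)
    with many_candidates_imp_forces[of t "[]" a u] start \<open>u \<in> R\<close> assms(1) show ?thesis
      by (simp add: stack_def)
  qed
  moreover have "seeker_wins G lab (stack n a)" if "\<forall>u\<in>R. seeker_forces R (u, u)" for n
    using forces_imp_seeker_wins_stack that start by blast
  ultimately show ?thesis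
    unfolding seeker_wins_two_string_iff_forces[OF assms(1)] stack_def by blast
qed

end
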